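(* Let $s\in\mathbb{R}\setminus\{0\}$ and $\beta\in\mathcal{B}_2$. Then the limit $f(s)=\lim_{n\to+\infty}f_n(s)$ exists and the following statements are true: 1. $0<f(s)<f_{n+1}(s)<f_n(s)<1$ for all $n\in\mathbb{N}$; 2. $f(\cdot)\in L^p(\mathbb{R})$ for all $p>0$; 3. $g(s)=\lim_{n\to+\infty}g_n(s)$ is finite if and only if $b_1(\beta)<+\infty$; 4. $\Phi_n(s,\beta)$ has a limit as $n\to+\infty$ if and only if $b_1(\beta)<+\infty$. If $s=0$, then $\Phi(0,\beta)=1$, $f(0)=1$ and $g(0)=0$, where $\Phi(0,\beta)=\lim_{n\to+\infty}\Phi_n(0,\beta)$.
   Context: For $k\in\mathbb{N}=\{1,2,\dots\}$ and a sequence $\beta=\{\beta_j\}_{j=1}^{+\infty}$ of positive reals, $b_k(\beta)=\sum_{j=1}^{+\infty}\beta_j^{-k}\in(0,+\infty]$; $\mathcal{B}_k$ is the set of such sequences with $b_k(\beta)<+\infty$. For $n\in\mathbb{N}$, $s\in\mathbb{R}$, $$\Phi_n(s,\beta)=\prod_{j=1}^{n}\int_{\mathbb{R}}\frac{\mathrm{d}a_j}{\sqrt{\pi/\beta_j}}\,e^{-\beta_j a_j^2+isa_j^2},$$ $$f_n(s)=\prod_{j=1}^{n}\Big(1+s^2/\beta_j^2\Big)^{-1/4},\qquad g_n(s)=\sum_{j=1}^n\arctan(s/\beta_j).$$ $L^p(\mathbb{R})$ for $p>0$ means measurable functions with $\int_{\mathbb{R}}|f|^p<+\infty$. *)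

theory Defs
  imports "HOL-Analysis.Analysis"
begin

text \<open>
  A sequence \<open>\<beta>\<^sub>1, \<beta>\<^sub>2, \<dots>\<close> is a function \<open>\<beta> :: nat \<Rightarrow> real\<close> of which only the values at
  indices \<open>j \<ge> 1\<close> are ever used; \<open>\<beta> 0\<close> is irrelevant.
\<close>

definition b_sum :: "nat \<Rightarrow> (nat \<Rightarrow> real) \<Rightarrow> ennreal" where
  "b_sum k \<beta> = (\<Sum>j. ennreal (1 / \<beta> (Suc j) ^ k))"

definition B_class :: "nat \<Rightarrow> (nat \<Rightarrow> real) set" where
  "B_class k = {\<beta>. (\<forall>j\<ge>1. 0 < \<beta> j) \<and> b_sum k \<beta> < \<infinity>}"

definition Phi_n :: "nat \<Rightarrow> real \<Rightarrow> (nat \<Rightarrow> real) \<Rightarrow> complex" where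
  "Phi_n n s \<beta> = (\<Prod>j=1..n. LINT a|lborel.
     exp (- complex_of_real (\<beta> j * a\<^sup>2) + \<i> * complex_of_real (s * a\<^sup>2))
       / complex_of_real (sqrt (pi / \<beta> j)))"

definition f_n :: "(nat \<Rightarrow> real) \<Rightarrow> nat \<Rightarrow> real \<Rightarrow> real" where
  "f_n \<beta> n s = (\<Prod>j=1..n. (1 + s\<^sup>2 / (\<beta> j)\<^sup>2) powr (- 1 / 4))"

definition g_n :: "(nat \<Rightarrow> real) \<Rightarrow> nat \<Rightarrow> real \<Rightarrow> real" where
  "g_n \<beta> n s = (\<Sum>j=1..n. arctan (s / \<beta> j))"

text \<open>
  The limits below are meaningful only together with a proof that the sequence in question
  is convergent. The limit of \<open>g_n\<close> is taken in the extended reals, where it may be infinite.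
\<close>

definition Phi_lim :: "real \<Rightarrow> (nat \<Rightarrow> real) \<Rightarrow> complex" where
  "Phi_lim s \<beta> = lim (\<lambda>n. Phi_n n s \<beta>)"

definition f_lim :: "(nat \<Rightarrow> real) \<Rightarrow> real \<Rightarrow> real" where
  "f_lim \<beta> s = lim (\<lambda>n. f_n \<beta> n s)"

definition g_lim :: "(nat \<Rightarrow> real) \<Rightarrow> real \<Rightarrow> ereal" where
  "g_lim \<beta> s = lim (\<lambda>n. ereal (g_n \<beta> n s))"

definition L_p :: "real \<Rightarrow> (real \<Rightarrow> real) set" where
  "L_p p = {h. h \<in> borel_measurable lebesgue \<and>
     (\<integral>\<^sup>+ x. ennreal (\<bar>h x\<bar> powr p) \<partial>lebesgue) < \<infinity>}"

end

theory Submission imports Defs "HOL-Probability.Probability" "HOL-Real_Asymp.Real_Asymp" begin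

text \<open>
  Each factor of \<open>\<Phi>\<^sub>n\<close> is a Gaussian integral with complex parameter \<open>\<beta>\<^sub>j - i s\<close>. Its square is
  elementary by Fubini, and continuity in \<open>s\<close> selects the branch of the square root that is \<open>1\<close>
  at \<open>s = 0\<close>; hence \<open>\<Phi>\<^sub>n = f\<^sub>n exp (i g\<^sub>n / 2)\<close>. Since \<open>f\<^sub>n\<close> decreases to a positive limit, \<open>\<Phi>\<^sub>n\<close>
  converges if and only if the phase does. The steps of \<open>g\<^sub>n / 2\<close> are below \<open>\<pi> / 4\<close>, so the phase
  cannot converge on the circle without \<open>g\<^sub>n\<close> itself converging, and as \<open>arctan x \<sim> x\<close> at \<open>0\<close> this
  means \<open>b\<^sub>1 < \<infinity>\<close>. For \<open>L\<^sup>p\<close>, bound \<open>f\<close> by a single \<open>f\<^sub>n\<close> with \<open>n p \<ge> 4\<close>.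
\<close>

section \<open>Gaussian integrals with complex parameter\<close>

text \<open>Up to the factor \<open>sqrt (pi / c)\<close>, the integrand is an absolute moment of
  the centred normal density with variance \<open>1 / (2 * c)\<close>. Exponent 1 serves the
  elementary inner integral, exponent 0 the dominated convergence in
  \<open>complex_gauss_integral\<close>.\<close>

lemma integrable_abs_power_gauss:
  fixes c :: real
  assumes "0 < c"
  shows "integrable lborel (\<lambda>x. \<bar>x\<bar> ^ k * exp (- (c * x\<^sup>2)))"
proof -
  define \<sigma> where "\<sigma> = 1 / sqrt (2 * c)"
  have \<sigma>: "0 < \<sigma>" "2 * \<sigma>\<^sup>2 = 1 / c"
    using assms by (auto simp: \<sigma>_def power_divide)
  have "integrable lborel (\<lambda>x. sqrt (pi / c) * (normal_density 0 \<sigma> x * \<bar>x - 0\<bar> ^ k))"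
    using \<sigma>(1) by (intro integrable_mult_right integrable_normal_moment_abs)
  also have "(\<lambda>x. sqrt (pi / c) * (normal_density 0 \<sigma> x * \<bar>x - 0\<bar> ^ k)) =
      (\<lambda>x. \<bar>x\<bar> ^ k * exp (- (c * x\<^sup>2)))"
  proof
    fix x
    have *: "2 * pi * \<sigma>\<^sup>2 = pi / c" "x\<^sup>2 / (2 * \<sigma>\<^sup>2) = c * x\<^sup>2"
      using \<sigma>(2) by (simp_all add: mult.assoc mult.left_commute)
    show "sqrt (pi / c) * (normal_density 0 \<sigma> x * \<bar>x - 0\<bar> ^ k) = \<bar>x\<bar> ^ k * exp (- (c * x\<^sup>2))"
      unfolding normal_density_def using assms * by simp
  qed
  finally show ?thesis .
qed

lemma integrable_abs_power_complex_gauss: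
  fixes z :: complex
  assumes "0 < Re z"
  shows "integrable lborel (\<lambda>x. complex_of_real (\<bar>x\<bar> ^ k) * exp (- (z * complex_of_real (x\<^sup>2))))"
  by (rule Bochner_Integration.integrable_bound[OF integrable_abs_power_gauss[OF assms, of k]])
     (auto simp: norm_mult norm_power intro!: AE_I2)

text \<open>The weight \<open>\<bar>x\<bar>\<close> provides the antiderivative \<open>?F\<close> on
  the positive half-line, where the integral is \<open>1 / (2 * z)\<close>; evenness doubles it.
  This is the inner integral that arises after Fubini in the square of the Gaussian
  integral.\<close>

lemma has_bochner_integral_abs_complex_gauss:
  fixes z :: complex
  assumes z: "0 < Re z"
  shows "has_bochner_integral lborel
    (\<lambda>x. complex_of_real \<bar>x\<bar> * exp (- (z * complex_of_real (x\<^sup>2)))) (1 / z)"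
proof -
  let ?f = "\<lambda>x. complex_of_real \<bar>x\<bar> * exp (- (z * complex_of_real (x\<^sup>2)))"
  let ?F = "\<lambda>x. - exp (- (z * complex_of_real (x\<^sup>2))) / (2 * z)"
  have z0: "z \<noteq> 0" using z by auto
  have int: "integrable lborel ?f"
    using integrable_abs_power_complex_gauss[OF z, of 1] by simp
  have set_int: "set_integrable lborel A ?f" if "A \<in> sets borel" for A
    unfolding set_integrable_def using that int by (intro integrable_mult_indicator) auto
  have "((\<lambda>x. exp (- (Re z * x\<^sup>2))) \<longlongrightarrow> 0) at_top"
    using z by real_asymp
  then have "((\<lambda>x. norm (exp (- (z * complex_of_real (x\<^sup>2))))) \<longlongrightarrow> 0) at_top"
    by simp
  then have "((\<lambda>x. exp (- (z * complex_of_real (x\<^sup>2)))) \<longlongrightarrow> 0) at_top"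
    by (rule tendsto_norm_zero_cancel)
  then have "(?F \<longlongrightarrow> - 0 / (2 * z)) at_top"
    using z0 by (intro tendsto_intros) auto
  then have B: "(((\<lambda>x. ?F x) \<circ> real_of_ereal) \<longlongrightarrow> 0) (at_left \<infinity>)"
    by (simp add: ereal_tendsto_simps)
  have "(?F \<longlongrightarrow> ?F 0) (at_right 0)"
    using z0 by (intro tendsto_intros) auto
  then have A: "(((\<lambda>x. ?F x) \<circ> real_of_ereal) \<longlongrightarrow> - 1 / (2 * z)) (at_right 0)"
    by (simp add: ereal_tendsto_simps zero_ereal_def)
  have "(LBINT x=0..\<infinity>. ?f x) = 0 - (- 1 / (2 * z))"
  proof (rule interval_integral_FTC_integrable[OF _ _ _ _ A B])
    fix x :: real assume "0 < ereal x"
    then have x: "0 < x" by simp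
    have "((\<lambda>w. - exp (- (z * w\<^sup>2)) / (2 * z)) has_field_derivative ?f x) (at (complex_of_real x))"
      using x z0 by (auto intro!: derivative_eq_intros simp: field_simps)
    from has_vector_derivative_real_field[OF this]
    show "(?F has_vector_derivative ?f x) (at x)" by simp
  next
    show "set_integrable lborel (einterval 0 \<infinity>) ?f" by (rule set_int) simp
  qed (auto intro!: continuous_intros)
  then have "(LBINT x:{0<..}. ?f x) = 1 / (2 * z)"
    by (simp add: interval_lebesgue_integral_0_infty)
  \<comment> \<open>The rule for even functions is stated for the closed half-line; the endpoint is
    a null set.\<close>
  moreover have "(LBINT x:{0<..}. ?f x) = (LBINT x:{0..}. ?f x)"
    unfolding set_lebesgue_integral_def
    by (intro integral_cong_AE)
       (use AE_lborel_singleton[of 0] in \<open>auto split: split_indicator elim!: eventually_mono\<close>)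
  ultimately have "has_bochner_integral lborel (\<lambda>x. indicator {0..} x *\<^sub>R ?f x) (1 / (2 * z))"
    using set_int[of "{0..}"]
    by (simp add: has_bochner_integral_iff set_lebesgue_integral_def set_integrable_def)
  from has_bochner_integral_even_function[OF this] show ?thesis
    by (simp add: scaleR_conv_of_real)
qed

lemma has_bochner_integral_inverse_1_plus_square:
  "has_bochner_integral lborel (\<lambda>x::real. inverse (1 + x\<^sup>2)) pi"
  using integrable_inverse_1_plus_square LBINT_inverse_1_plus_square
  by (simp add: has_bochner_integral_iff set_integrable_def interval_lebesgue_integral_def
      set_lebesgue_integral_def)

text \<open>The substitution \<open>y = x t\<close> in the second factor makes the inner integral elementary after
  exchanging the order of integration.\<close>

lemma complex_gauss_integral_square:
  fixes z :: complex
  assumes z: "0 < Re z"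
  shows "(LINT x|lborel. exp (- (z * complex_of_real (x\<^sup>2))))\<^sup>2 = pi / z"
proof -
  let ?e = "\<lambda>x::real. exp (- (z * complex_of_real (x\<^sup>2)))"
  let ?I = "LINT x|lborel. ?e x"
  let ?f = "\<lambda>t x::real. complex_of_real \<bar>x\<bar> * exp (- (z * (1 + complex_of_real (t\<^sup>2)) * complex_of_real (x\<^sup>2)))"
  have pos: "0 < Re (z * (1 + complex_of_real (t\<^sup>2)))" for t
  proof -
    have "Re (z * (1 + complex_of_real (t\<^sup>2))) = Re z * (1 + t\<^sup>2)"
      by (simp add: algebra_simps flip: of_real_power)
    then show ?thesis using z by (simp add: add_pos_nonneg)
  qed
  note inner = has_bochner_integral_abs_complex_gauss[OF pos]
  \<comment> \<open>The modulus of \<open>?f t x\<close> is the same integrand with the real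
    parameter \<open>?c\<close> instead of the complex one, so the previous lemma also evaluates the
    inner norm integral that Fubini requires.\<close>
  have norm_f: "(LINT x|lborel. norm (?f t x)) = inverse (Re z) * inverse (1 + t\<^sup>2)" for t
  proof -
    let ?c = "Re (z * (1 + complex_of_real (t\<^sup>2)))"
    have "has_bochner_integral lborel
      (\<lambda>x. complex_of_real \<bar>x\<bar> * exp (- (complex_of_real ?c * complex_of_real (x\<^sup>2)))) (1 / complex_of_real ?c)"
      using pos[of t] by (intro has_bochner_integral_abs_complex_gauss) simp
    also have "(\<lambda>x. complex_of_real \<bar>x\<bar> * exp (- (complex_of_real ?c * complex_of_real (x\<^sup>2)))) =
      (\<lambda>x. complex_of_real (norm (?f t x)))"
    proof
      fix x :: real
      have "exp (- (complex_of_real ?c * complex_of_real (x\<^sup>2))) = complex_of_real (exp (- (?c * x\<^sup>2)))"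
        by (simp only: of_real_mult of_real_minus flip: exp_of_real)
      then show "complex_of_real \<bar>x\<bar> * exp (- (complex_of_real ?c * complex_of_real (x\<^sup>2))) =
          complex_of_real (norm (?f t x))"
        by (simp add: norm_mult flip: of_real_power)
    qed
    finally have "complex_of_real (LINT x|lborel. norm (?f t x)) = complex_of_real (1 / ?c)"
      by (simp only: has_bochner_integral_iff integral_complex_of_real of_real_divide of_real_1)
    then have "(LINT x|lborel. norm (?f t x)) = 1 / ?c"
      by (simp only: of_real_eq_iff)
    then show ?thesis
      by (simp add: field_simps flip: of_real_power)
  qed
  have "integrable (lborel \<Otimes>\<^sub>M lborel) (case_prod ?f)"
  proof (rule lborel_pair.Fubini_integrable)
    show "integrable lborel (\<lambda>t. LINT x|lborel. norm (case_prod ?f (t, x)))"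
      using has_bochner_integral_inverse_1_plus_square
      unfolding prod.case norm_f by (intro integrable_mult_right) (simp add: has_bochner_integral_iff)
    show "AE t in lborel. integrable lborel (\<lambda>x. case_prod ?f (t, x))"
      using inner by (auto simp: has_bochner_integral_iff)
  qed measurable
  note fub = lborel_pair.Fubini_integral[OF this]
  have "?I\<^sup>2 = (LINT x|lborel. ?e x * ?I)"
    by (simp add: power2_eq_square)
  also have "\<dots> = (LINT x|lborel. LINT t|lborel. ?f t x)"
  proof (rule integral_cong_AE)
    \<comment> \<open>At \<open>x = 0\<close> the substitution breaks down: the right side is 0
      there, but the left side is \<open>?I\<close>. Hence the identity is used almost everywhere
      only.\<close>
    have "?e x * ?I = (LINT t|lborel. ?f t x)" if "x \<noteq> 0" for x
    proof -
      have "?I = \<bar>x\<bar> *\<^sub>R (LINT t|lborel. ?e (0 + x * t))"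
        by (rule lborel_integral_real_affine[OF that])
      then have "?e x * ?I = (LINT t|lborel. (?e x * complex_of_real \<bar>x\<bar>) * ?e (x * t))"
        by (simp add: scaleR_conv_of_real)
      also have "\<dots> = (LINT t|lborel. ?f t x)"
        by (intro Bochner_Integration.integral_cong)
           (auto simp: algebra_simps exp_add[symmetric] power_mult_distrib exp_minus_inverse)
      finally show ?thesis .
    qed
    then show "AE x in lborel. ?e x * ?I = (LINT t|lborel. ?f t x)"
      using AE_lborel_singleton[of 0] by (auto elim!: eventually_mono)
  qed measurable
  also have "\<dots> = (LINT t|lborel. LINT x|lborel. ?f t x)"
    by (rule fub)
  also have "\<dots> = (LINT t|lborel. (1 / z) * complex_of_real (inverse (1 + t\<^sup>2)))"
    using inner by (simp add: has_bochner_integral_iff field_simps)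
  also have "\<dots> = (1 / z) * complex_of_real pi"
    using has_bochner_integral_inverse_1_plus_square
    by (simp only: integral_mult_right_zero integral_complex_of_real has_bochner_integral_iff)
  finally show ?thesis by simp
qed

section \<open>Choice of the branch and value of one factor\<close>

lemma cis_arctan: "cis (arctan x) = (1 + \<i> * complex_of_real x) / complex_of_real (sqrt (1 + x\<^sup>2))"
  by (simp add: complex_eq_iff cos_arctan sin_arctan)

text \<open>The number \<open>w\<close> has half the argument of 1/(1 - ix) and the square root of
  its modulus. With x = s/b it is the candidate for one factor of \<open>Phi_n\<close>; that it
  never vanishes allows division by it.\<close>

lemma inverse_one_minus_i_square_root:
  fixes x :: real
  defines "w \<equiv> complex_of_real ((1 + x\<^sup>2) powr (- 1 / 4)) * cis (arctan x / 2)"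
  shows "w\<^sup>2 = 1 / (1 - \<i> * complex_of_real x)" "w \<noteq> 0"
proof -
  have pos: "0 < 1 + x\<^sup>2" by (simp add: add_pos_nonneg)
  then show "w \<noteq> 0" by (simp add: w_def)
  have nz: "1 - \<i> * complex_of_real x \<noteq> 0" by (simp add: complex_eq_iff)
  have "((1 + x\<^sup>2) powr (- 1 / 4))\<^sup>2 = (1 + x\<^sup>2) powr (- (1 / 2))"
    by (simp add: power2_eq_square flip: powr_add)
  also have "\<dots> = 1 / sqrt (1 + x\<^sup>2)"
    using pos by (simp only: powr_minus powr_half_sqrt less_imp_le inverse_eq_divide)
  finally have "w\<^sup>2 = complex_of_real (1 / sqrt (1 + x\<^sup>2)) * cis (arctan x)"
    by (simp add: w_def power_mult_distrib power2_eq_square[of "cis _"] cis_mult flip: of_real_power)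
  also have "\<dots> = (1 + \<i> * complex_of_real x) / (complex_of_real (sqrt (1 + x\<^sup>2)))\<^sup>2"
    by (simp add: cis_arctan power2_eq_square)
  also have "(complex_of_real (sqrt (1 + x\<^sup>2)))\<^sup>2 = (1 + \<i> * complex_of_real x) * (1 - \<i> * complex_of_real x)"
    using pos by (simp add: algebra_simps power2_eq_square flip: of_real_mult)
  finally show "w\<^sup>2 = 1 / (1 - \<i> * complex_of_real x)"
    using nz by (auto simp: complex_eq_iff power2_eq_square)
qed

text \<open>The integral \<open>J\<close> and the candidate \<open>K\<close> have equal squares, so
  their quotient takes values in {1, -1}. It is continuous in \<open>s\<close>, hence constant, and
  at \<open>s = 0\<close> the integrand is real and nonnegative, which excludes -1.\<close>

lemma complex_gauss_integral:
  fixes b s :: real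
  assumes b: "0 < b"
  shows "(LINT a|lborel. exp (- complex_of_real (b * a\<^sup>2) + \<i> * complex_of_real (s * a\<^sup>2))
       / complex_of_real (sqrt (pi / b))) =
     complex_of_real ((1 + s\<^sup>2 / b\<^sup>2) powr (- 1 / 4)) * cis (arctan (s / b) / 2)"
proof -
  let ?h = "\<lambda>s a. exp (- complex_of_real (b * a\<^sup>2) + \<i> * complex_of_real (s * a\<^sup>2))
       / complex_of_real (sqrt (pi / b))"
  define J where "J s = (LINT a|lborel. ?h s a)" for s
  define K where "K s = complex_of_real ((1 + (s / b)\<^sup>2) powr (- 1 / 4)) * cis (arctan (s / b) / 2)" for s
  note K = inverse_one_minus_i_square_root[of "s / b" for s, folded K_def]
  \<comment> \<open>The norm does not depend on \<open>s\<close>, so one Gaussian dominates the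
    integrands for all \<open>s\<close>. The power \<open>\<bar>a\<bar> ^ 0\<close> is kept to match
    \<open>integrable_abs_power_gauss\<close>.\<close>
  have norm_h: "norm (?h s a) = \<bar>a\<bar> ^ 0 * exp (- (b * a\<^sup>2)) / sqrt (pi / b)" for s a
    using b by (simp add: norm_divide)
  have J2: "(J s)\<^sup>2 = 1 / (1 - \<i> * complex_of_real (s / b))" for s
  proof -
    define z where "z = complex_of_real b - \<i> * complex_of_real s"
    have z: "0 < Re z" "z \<noteq> 0" using b by (auto simp: z_def complex_eq_iff)
    have h: "?h s a = exp (- (z * complex_of_real (a\<^sup>2))) / complex_of_real (sqrt (pi / b))" for a
      by (simp add: z_def algebra_simps)
    have "J s = (LINT a|lborel. exp (- (z * complex_of_real (a\<^sup>2)))) / complex_of_real (sqrt (pi / b))"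
      unfolding J_def h by (rule integral_divide_zero)
    then have "(J s)\<^sup>2 = (pi / z) / complex_of_real ((sqrt (pi / b))\<^sup>2)"
      by (simp only: power_divide complex_gauss_integral_square[OF z(1)]) (simp only: of_real_power)
    also have "\<dots> = b / z"
      using b z by simp
    also have "\<dots> = 1 / (1 - \<i> * complex_of_real (s / b))"
      using b z by (simp add: z_def field_simps)
    finally show ?thesis .
  qed
  have "isCont J s" for s
    unfolding continuous_at_sequentially comp_def
  proof (intro allI impI)
    fix u :: "nat \<Rightarrow> real" assume u: "u \<longlonglongrightarrow> s"
    show "(\<lambda>n. J (u n)) \<longlonglongrightarrow> J s"
      unfolding J_def
    proof (rule integral_dominated_convergence)
      show "integrable lborel (\<lambda>a. \<bar>a\<bar> ^ 0 * exp (- (b * a\<^sup>2)) / sqrt (pi / b))"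
        using integrable_abs_power_gauss[OF b, of 0] by (intro integrable_divide) auto
      show "AE a in lborel. norm (?h (u n) a) \<le> \<bar>a\<bar> ^ 0 * exp (- (b * a\<^sup>2)) / sqrt (pi / b)" for n
        unfolding norm_h by simp
      show "AE a in lborel. (\<lambda>n. ?h (u n) a) \<longlonglongrightarrow> ?h s a"
        using u b by (intro AE_I2 tendsto_intros) auto
    qed auto
  qed
  moreover have "isCont K s" for s
    using b unfolding K_def cis_conv_exp
    by (intro continuous_intros) (auto simp: add_nonneg_eq_0_iff)
  ultimately have cont: "continuous_on UNIV (\<lambda>s. J s / K s)"
    using K(2) by (intro continuous_at_imp_continuous_on ballI continuous_intros) auto
  have "(J s / K s)\<^sup>2 = 1" for s
    using K(1)[of s] K(2)[of s] J2[of s] by (simp add: power_divide)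
  then have pm: "J s / K s = 1 \<or> J s / K s = - 1" for s
    by (simp add: power2_eq_1_iff)
  then have "(\<lambda>s. J s / K s) ` UNIV \<subseteq> {1, - 1}" by blast
  then have "finite ((\<lambda>s. J s / K s) ` UNIV)" by (rule finite_subset) simp
  then have "(\<lambda>s. J s / K s) constant_on UNIV"
    using cont connected_UNIV by (intro continuous_finite_range_constant)
  then obtain c where c: "J s / K s = c" for s by (auto simp: constant_on_def)
  have "J 0 = complex_of_real (LINT a|lborel. exp (- (b * a\<^sup>2)) / sqrt (pi / b))" (is "_ = complex_of_real ?r")
    unfolding J_def integral_complex_of_real[symmetric]
    by (intro Bochner_Integration.integral_cong refl)
       (simp only: mult_zero_left of_real_0 mult_zero_right add_0_right of_real_divide of_real_minus
          flip: exp_of_real)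
  moreover have "0 \<le> ?r" using b by (intro integral_nonneg_AE) auto
  moreover have "K 0 = 1" by (simp add: K_def)
  ultimately have "0 \<le> Re (J 0 / K 0)" by simp
  then have "J 0 / K 0 \<noteq> - 1" by (metis one_complex.sel(1) uminus_complex.sel(1) neg_0_le_iff_le not_one_le_zero)
  then have "c = 1" using pm[of 0] c[of 0] by auto
  then have "J s = K s" using c[of s] K(2)[of s] by simp
  then show ?thesis by (simp only: J_def K_def power_divide)
qed

section \<open>Lifting convergence from the circle to angles\<close>

text \<open>A sequence of angles with small steps lifts the convergence of the points on the circle: near
  the limit, the principal argument has the same increments as the sequence.\<close>

lemma convergent_cis_imp_convergent:
  fixes h :: "nat \<Rightarrow> real"
  assumes conv: "convergent (\<lambda>n. cis (h n))" and step: "\<And>n. \<bar>h (Suc n) - h n\<bar> \<le> 1"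
  shows "convergent h"
proof -
  obtain L where L: "(\<lambda>n. cis (h n)) \<longlonglongrightarrow> L" using conv by (auto simp: convergent_def)
  then have "(\<lambda>n. norm (cis (h n))) \<longlonglongrightarrow> norm L" by (rule tendsto_norm)
  then have "norm L = 1" by (simp add: LIMSEQ_const_iff)
  then have L0: "L \<noteq> 0" by auto
  \<comment> \<open>Division by \<open>L\<close> moves the limit point to 1, away from the branch
    cut, so \<open>Arg\<close> is continuous there.\<close>
  define \<theta> where "\<theta> n = Arg (cis (h n) / L)" for n
  have "(\<lambda>n. cis (h n) / L) \<longlonglongrightarrow> L / L" using L L0 by (intro tendsto_intros)
  then have "(\<lambda>n. cis (h n) / L) \<longlonglongrightarrow> 1" using L0 by simp
  then have "\<theta> \<longlonglongrightarrow> Arg 1"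
    unfolding \<theta>_def by (intro isCont_tendsto_compose[of _ Arg] continuous_at_Arg) auto
  then have \<theta>: "\<theta> \<longlonglongrightarrow> 0" by (simp add: Arg_of_real[of 1, simplified])
  have cis_\<theta>: "cis (\<theta> n) = cis (h n) / L" for n
    unfolding \<theta>_def using L0 \<open>norm L = 1\<close> by (subst cis_Arg) (auto simp: sgn_div_norm norm_divide)
  from \<theta> have "eventually (\<lambda>n. \<bar>\<theta> n\<bar> < 1) sequentially"
    using order_tendstoD(2)[OF tendsto_rabs_zero[OF \<theta>], of 1] by simp
  then obtain N where N: "\<And>n. N \<le> n \<Longrightarrow> \<bar>\<theta> n\<bar> < 1" by (auto simp: eventually_sequentially)
  have same: "h (Suc n) - \<theta> (Suc n) = h n - \<theta> n" if "N \<le> n" for n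
  proof -
    define D where "D = (h (Suc n) - \<theta> (Suc n)) - (h n - \<theta> n)"
    have "cis (h m - \<theta> m) = L" for m
      using L0 cis_\<theta>[of m] by (simp add: cis_divide[symmetric])
    then have "cis D = 1" using L0 by (simp add: D_def cis_divide[symmetric])
    then have "cos D = 1" by (metis cis.sel(1) one_complex.sel(1))
    then obtain k :: int where k: "D = of_int k * (2 * pi)" by (auto simp: cos_one_2pi_int)
    \<comment> \<open>Two principal arguments below 1 and one step of at most 1 add up to less than
      3, whereas a nonzero multiple of 2 pi exceeds 6 in modulus.\<close>
    have "\<bar>D\<bar> < 3" using N[OF that] N[of "Suc n"] that step[of n] by (simp add: D_def)
    also have "3 < 2 * pi" using pi_gt3 by simp
    finally have "\<bar>real_of_int k\<bar> * (2 * pi) < 1 * (2 * pi)" by (simp add: k abs_mult)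
    then have "\<bar>real_of_int k\<bar> < 1" by (rule mult_right_less_imp_less) simp
    then have "k = 0" by linarith
    then show ?thesis using k by (simp add: D_def)
  qed
  have "\<theta> n + (h N - \<theta> N) = h n" if "N \<le> n" for n
    using that
  proof (induction n rule: dec_induct)
    case (step m)
    then show ?case using same[of m] by linarith
  qed simp
  then have "eventually (\<lambda>n. \<theta> n + (h N - \<theta> N) = h n) sequentially"
    by (rule eventually_sequentiallyI)
  moreover have "(\<lambda>n. \<theta> n + (h N - \<theta> N)) \<longlonglongrightarrow> 0 + (h N - \<theta> N)"
    by (intro tendsto_intros \<theta>)
  ultimately have "h \<longlonglongrightarrow> 0 + (h N - \<theta> N)" by (rule Lim_transform_eventually[rotated])
  then show ?thesis by (auto simp: convergent_def)
qed

text \<open>Since arctan x ~ x at 0, each function is big-O of the other, and the comparison test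
  applies in both directions. Nonzero terms are what puts the sequence into the punctured filter
  \<open>at 0\<close>.\<close>

lemma summable_arctan_iff:
  fixes x :: "nat \<Rightarrow> real"
  assumes lim: "x \<longlonglongrightarrow> 0" and nz: "\<And>j. x j \<noteq> 0"
  shows "summable (\<lambda>j. \<bar>arctan (x j)\<bar>) \<longleftrightarrow> summable (\<lambda>j. \<bar>x j\<bar>)"
proof -
  have fl: "filterlim x (at 0) sequentially"
    using lim nz by (simp add: filterlim_at)
  have "(\<lambda>x::real. x) \<in> O[at 0](arctan)" "arctan \<in> O[at 0](\<lambda>x::real. x)"
    by (real_asymp simp: at_eq_sup_left_right)+
  from this[THEN landau_o.big.compose, OF fl]
  show ?thesis
    using summable_comparison_test_bigo by fastforce
qed

section \<open>Recursions, summability and polar form of the products\<close>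

lemma f_n_Suc: "f_n \<beta> (Suc n) s = f_n \<beta> n s * (1 + s\<^sup>2 / (\<beta> (Suc n))\<^sup>2) powr (- 1 / 4)"
  by (simp add: f_n_def)

lemma g_n_Suc: "g_n \<beta> (Suc n) s = g_n \<beta> n s + arctan (s / \<beta> (Suc n))"
  by (simp add: g_n_def)

lemma B_class_pos: "\<beta> \<in> B_class k \<Longrightarrow> \<forall>j\<ge>1. 0 < \<beta> j"
  by (simp add: B_class_def)

lemma b_sum_finite_iff_summable:
  assumes "\<forall>j\<ge>1. 0 < \<beta> j"
  shows "b_sum k \<beta> < \<infinity> \<longleftrightarrow> summable (\<lambda>j. 1 / \<beta> (Suc j) ^ k)"
proof -
  have nn: "0 \<le> 1 / \<beta> (Suc j) ^ k" for j using assms by (simp add: less_imp_le)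
  show ?thesis
    using summable_suminf_not_top[OF nn] suminf_ennreal2[OF nn]
    by (auto simp: b_sum_def less_top)
qed

lemma Phi_n_eq:
  assumes "\<forall>j\<ge>1. 0 < \<beta> j"
  shows "Phi_n n s \<beta> = complex_of_real (f_n \<beta> n s) * cis (g_n \<beta> n s / 2)"
proof (induction n)
  case 0
  then show ?case by (simp add: Phi_n_def f_n_def g_n_def)
next
  case (Suc n)
  have pos: "0 < \<beta> (Suc n)" using assms by simp
  have "Phi_n (Suc n) s \<beta> = Phi_n n s \<beta> *
      (complex_of_real ((1 + s\<^sup>2 / (\<beta> (Suc n))\<^sup>2) powr (- 1 / 4)) * cis (arctan (s / \<beta> (Suc n)) / 2))"
    unfolding Phi_n_def complex_gauss_integral[OF pos, symmetric] by simp
  then show ?case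
    by (simp add: Suc f_n_Suc g_n_Suc add_divide_distrib cis_mult[symmetric])
qed

section \<open>Monotonicity and positive limit of the moduli\<close>

lemma powr_neg_quarter_ge_exp:
  fixes x :: real
  assumes "0 \<le> x"
  shows "exp (- x / 4) \<le> (1 + x) powr (- 1 / 4)"
  using assms ln_add_one_self_le_self[of x] by (simp add: powr_def)

lemma f_n_pos: "0 < f_n \<beta> n s"
  unfolding f_n_def by (intro prod_pos) (auto simp: add_nonneg_eq_0_iff)

lemma f_n_Suc_less:
  assumes "0 < \<beta> (Suc n)" "s \<noteq> 0"
  shows "f_n \<beta> (Suc n) s < f_n \<beta> n s"
proof -
  have "1 < 1 + s\<^sup>2 / (\<beta> (Suc n))\<^sup>2" using assms by simp
  then have "(1 + s\<^sup>2 / (\<beta> (Suc n))\<^sup>2) powr (- 1 / 4) < 1"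
    using powr_less_mono[of "- 1 / 4" 0 "1 + s\<^sup>2 / (\<beta> (Suc n))\<^sup>2"] by simp
  then show ?thesis using f_n_pos[of \<beta> n s] by (simp add: f_n_Suc)
qed

text \<open>Multiplying the bounds \<open>powr_neg_quarter_ge_exp\<close> turns the product into the
  exponential of a partial sum, which is at most the whole series. The bound is independent of
  \<open>n\<close> and thus keeps the limit of \<open>f_n\<close> positive.\<close>

lemma exp_le_f_n:
  assumes sm: "summable (\<lambda>j. 1 / \<beta> (Suc j) ^ 2)"
  shows "exp (- (s\<^sup>2 * (\<Sum>j. 1 / \<beta> (Suc j) ^ 2)) / 4) \<le> f_n \<beta> n s"
proof -
  have "(\<Sum>j<n. 1 / \<beta> (Suc j) ^ 2) \<le> (\<Sum>j. 1 / \<beta> (Suc j) ^ 2)"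
    using sm by (intro sum_le_suminf) auto
  then have "s\<^sup>2 * (\<Sum>j<n. 1 / \<beta> (Suc j) ^ 2) \<le> s\<^sup>2 * (\<Sum>j. 1 / \<beta> (Suc j) ^ 2)"
    by (intro mult_left_mono) auto
  then have "exp (- (s\<^sup>2 * (\<Sum>j. 1 / \<beta> (Suc j) ^ 2)) / 4) \<le> exp (- (s\<^sup>2 * (\<Sum>j<n. 1 / \<beta> (Suc j) ^ 2)) / 4)"
    by simp
  also have "- (s\<^sup>2 * (\<Sum>j<n. 1 / \<beta> (Suc j) ^ 2)) / 4 = (\<Sum>j<n. - (s\<^sup>2 / \<beta> (Suc j) ^ 2) / 4)"
    by (simp add: sum_distrib_left sum_negf sum_divide_distrib)
  also have "exp \<dots> = (\<Prod>j<n. exp (- (s\<^sup>2 / \<beta> (Suc j) ^ 2) / 4))"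
    by (simp add: exp_sum)
  also have "\<dots> \<le> (\<Prod>j<n. (1 + s\<^sup>2 / \<beta> (Suc j) ^ 2) powr (- 1 / 4))"
    by (intro prod_mono conjI powr_neg_quarter_ge_exp) auto
  also have "\<dots> = f_n \<beta> n s"
    by (simp add: f_n_def prod.atLeast1_atMost_eq)
  finally show ?thesis .
qed

lemma decseq_f_n:
  assumes "\<forall>j\<ge>1. 0 < \<beta> j"
  shows "decseq (\<lambda>n. f_n \<beta> n s)"
proof (cases "s = 0")
  case True
  then show ?thesis by (simp add: f_n_def)
next
  case False
  then show ?thesis
    using assms by (intro decseq_SucI less_imp_le f_n_Suc_less) auto
qed

lemma f_n_tendsto:
  assumes "\<beta> \<in> B_class 2"
  shows "(\<lambda>n. f_n \<beta> n s) \<longlonglongrightarrow> f_lim \<beta> s" and "0 < f_lim \<beta> s"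
proof -
  note pos = B_class_pos[OF assms]
  have sm: "summable (\<lambda>j. 1 / \<beta> (Suc j) ^ 2)"
    using assms b_sum_finite_iff_summable[OF pos] by (simp add: B_class_def)
  note low = exp_le_f_n[OF sm, of s]
  obtain L where L: "(\<lambda>n. f_n \<beta> n s) \<longlonglongrightarrow> L"
    using low by (rule decseq_convergent[OF decseq_f_n[OF pos], OF allI])
  then show tends: "(\<lambda>n. f_n \<beta> n s) \<longlonglongrightarrow> f_lim \<beta> s"
    by (simp add: f_lim_def limI)
  have "0 < exp (- (s\<^sup>2 * (\<Sum>j. 1 / \<beta> (Suc j) ^ 2)) / 4)" by simp
  also have "\<dots> \<le> f_lim \<beta> s"
    using tends low by (intro LIMSEQ_le_const) auto
  finally show "0 < f_lim \<beta> s" .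
qed

section \<open>Integrability of powers of the limit\<close>

lemma f_n_measurable: "f_n \<beta> n \<in> borel_measurable borel"
  unfolding f_n_def[abs_def] by measurable

text \<open>A common bound \<open>M\<close> of the first \<open>n\<close> entries gives
  \<open>f_n\<close> at most (1 + s^2/M^2)^(-n/4). Choosing \<open>n\<close> at least 4/p makes its
  p-th power at most 1/(1 + s^2/M^2).\<close>

lemma f_n_powr_le:
  fixes p :: real
  assumes pos: "\<forall>j\<ge>1. 0 < \<beta> j" and p: "0 < p"
  obtains n C where "0 < C" "\<And>s. f_n \<beta> n s powr p \<le> C * inverse (1 + s\<^sup>2)"
proof -
  obtain n :: nat where n: "4 / p \<le> real n" using real_arch_simple by blast
  \<comment> \<open>The sum bounds every single entry; the summand 1 gives \<open>1 \<le> M\<close>,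
    so that M^2 + s^2 can later be replaced by 1 + s^2 in the denominator.\<close>
  define M where "M = 1 + (\<Sum>j=1..n. \<beta> j)"
  have \<beta>_pos: "0 < \<beta> j" if "j \<in> {1..n}" for j
    using pos that by simp
  have "0 \<le> (\<Sum>j=1..n. \<beta> j)" using \<beta>_pos by (intro sum_nonneg) (simp add: less_imp_le)
  then have M: "1 \<le> M" by (simp add: M_def)
  have le_M: "\<beta> j \<le> M" if "j \<in> {1..n}" for j
    using member_le_sum[of j "{1..n}" \<beta>] that \<beta>_pos by (force simp: M_def intro: less_imp_le)
  have "f_n \<beta> n s powr p \<le> M\<^sup>2 * inverse (1 + s\<^sup>2)" for s
  proof -
    have "f_n \<beta> n s \<le> (\<Prod>j=1..n. (1 + s\<^sup>2 / M\<^sup>2) powr (- 1 / 4))"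
      unfolding f_n_def
    proof (intro prod_mono conjI powr_mono2' add_left_mono)
      fix j assume j: "j \<in> {1..n}"
      show "s\<^sup>2 / M\<^sup>2 \<le> s\<^sup>2 / (\<beta> j)\<^sup>2"
        using \<beta>_pos[OF j] le_M[OF j] by (intro divide_left_mono power_mono mult_pos_pos) auto
    qed (auto intro!: add_pos_nonneg)
    also have "\<dots> = (1 + s\<^sup>2 / M\<^sup>2) powr (- real n / 4)"
      by (simp add: powr_power add_nonneg_eq_0_iff)
    finally have "f_n \<beta> n s powr p \<le> ((1 + s\<^sup>2 / M\<^sup>2) powr (- real n / 4)) powr p"
      using p f_n_pos[of \<beta> n s] by (intro powr_mono2) auto
    also have "\<dots> \<le> (1 + s\<^sup>2 / M\<^sup>2) powr (- 1)"
      unfolding powr_powr using n p by (intro powr_mono) (auto simp: field_simps)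
    also have "\<dots> = inverse (1 + s\<^sup>2 / M\<^sup>2)"
      by (simp add: powr_minus add_nonneg_nonneg)
    also have "\<dots> = M\<^sup>2 / (M\<^sup>2 + s\<^sup>2)"
      using M by (simp add: field_simps)
    also have "\<dots> \<le> M\<^sup>2 / (1 + s\<^sup>2)"
      using M by (intro divide_left_mono add_right_mono mult_pos_pos add_pos_nonneg) auto
    finally show ?thesis by (simp add: divide_inverse)
  qed
  with M that[of "M\<^sup>2" n] show ?thesis by simp
qed

lemma f_lim_in_L_p:
  assumes \<beta>: "\<beta> \<in> B_class 2" and p: "0 < p"
  shows "f_lim \<beta> \<in> L_p p"
proof -
  note pos = B_class_pos[OF \<beta>]
  have meas: "f_lim \<beta> \<in> borel_measurable lborel"
    using borel_measurable_LIMSEQ_real[OF f_n_tendsto(1)[OF \<beta>] f_n_measurable] by simp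
  obtain n C where C: "0 < C" "\<And>s. f_n \<beta> n s powr p \<le> C * inverse (1 + s\<^sup>2)"
    using f_n_powr_le[OF pos p] by blast
  have bound: "\<bar>f_lim \<beta> s\<bar> powr p \<le> C * inverse (1 + s\<^sup>2)" for s
  proof -
    have "f_lim \<beta> s \<le> f_n \<beta> n s"
      using decseq_ge[OF decseq_f_n[OF pos] f_n_tendsto(1)[OF \<beta>]] .
    then have "\<bar>f_lim \<beta> s\<bar> powr p \<le> f_n \<beta> n s powr p"
      using f_n_tendsto(2)[OF \<beta>, of s] p by (intro powr_mono2) auto
    then show ?thesis using C(2)[of s] by (rule order_trans)
  qed
  have "(\<integral>\<^sup>+ s. ennreal (\<bar>f_lim \<beta> s\<bar> powr p) \<partial>lebesgue) \<le> (\<integral>\<^sup>+ s. ennreal (C * inverse (1 + s\<^sup>2)) \<partial>lebesgue)"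
    by (intro nn_integral_mono ennreal_leI bound)
  also have "\<dots> = (\<integral>\<^sup>+ s. ennreal (C * inverse (1 + s\<^sup>2)) \<partial>lborel)"
    by (simp add: nn_integral_completion)
  also have "\<dots> < \<infinity>"
    using integrable_mult_right[of C lborel "\<lambda>s::real. inverse (1 + s\<^sup>2)"] C(1)
      has_bochner_integral_inverse_1_plus_square
    by (subst nn_integral_eq_integral) (auto simp: has_bochner_integral_iff)
  finally show ?thesis
    using measurable_completion[OF meas] by (simp add: L_p_def)
qed

section \<open>Convergence of the angles\<close>

text \<open>No summand has the sign opposite to \<open>s\<close>, so the sequence is monotone. This
  makes the \<open>lim\<close> in \<open>g_lim\<close> a genuine limit.\<close>

lemma convergent_ereal_g_n:
  assumes "\<forall>j\<ge>1. 0 < \<beta> j"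
  shows "convergent (\<lambda>n. ereal (g_n \<beta> n s))"
proof (cases "0 \<le> s")
  case True
  then have "incseq (\<lambda>n. ereal (g_n \<beta> n s))"
    using assms by (intro incseq_SucI) (simp add: g_n_Suc less_imp_le)
  then show ?thesis by (auto simp: convergent_def dest: LIMSEQ_SUP)
next
  case False
  then have "decseq (\<lambda>n. ereal (g_n \<beta> n s))"
    using assms by (intro decseq_SucI) (simp add: g_n_Suc less_imp_le divide_nonpos_pos)
  then show ?thesis by (auto simp: convergent_def dest: LIMSEQ_INF)
qed

lemma g_lim_finite_iff_convergent:
  assumes "\<forall>j\<ge>1. 0 < \<beta> j"
  shows "\<bar>g_lim \<beta> s\<bar> \<noteq> \<infinity> \<longleftrightarrow> convergent (\<lambda>n. g_n \<beta> n s)"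
proof
  have lim: "(\<lambda>n. ereal (g_n \<beta> n s)) \<longlonglongrightarrow> g_lim \<beta> s"
    using convergent_ereal_g_n[OF assms] by (simp add: g_lim_def convergent_LIMSEQ_iff)
  assume "\<bar>g_lim \<beta> s\<bar> \<noteq> \<infinity>"
  then obtain r where "g_lim \<beta> s = ereal r" by auto
  with lim show "convergent (\<lambda>n. g_n \<beta> n s)" by (auto simp: convergent_def)
next
  assume "convergent (\<lambda>n. g_n \<beta> n s)"
  then obtain r where "(\<lambda>n. g_n \<beta> n s) \<longlonglongrightarrow> r" by (auto simp: convergent_def)
  then have "g_lim \<beta> s = ereal r" unfolding g_lim_def by (intro limI) simp
  then show "\<bar>g_lim \<beta> s\<bar> \<noteq> \<infinity>" by simp
qed

text \<open>All summands share the sign of \<open>s\<close>, so convergence means absolute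
  convergence, and \<open>summable_arctan_iff\<close> replaces each arctan by its argument. Square
  summability of 1/\<beta> supplies the required convergence of the arguments to 0.\<close>

lemma convergent_g_n_iff:
  assumes \<beta>: "\<beta> \<in> B_class 2" and s: "s \<noteq> 0"
  shows "convergent (\<lambda>n. g_n \<beta> n s) \<longleftrightarrow> b_sum 1 \<beta> < \<infinity>"
proof -
  note pos = B_class_pos[OF \<beta>]
  have "summable (\<lambda>j. 1 / \<beta> (Suc j) ^ 2)"
    using \<beta> b_sum_finite_iff_summable[OF pos] by (simp add: B_class_def)
  then have "(\<lambda>j. 1 / \<beta> (Suc j) ^ 2) \<longlonglongrightarrow> 0" by (rule summable_LIMSEQ_zero)
  then have "(\<lambda>j. s * sqrt (1 / \<beta> (Suc j) ^ 2)) \<longlonglongrightarrow> s * sqrt 0"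
    by (intro tendsto_intros)
  then have lim: "(\<lambda>j. s / \<beta> (Suc j)) \<longlonglongrightarrow> 0"
    using pos by (simp add: real_sqrt_divide less_imp_le)
  have pos_Suc: "0 < \<beta> (Suc j)" for j
    using pos by simp
  \<comment> \<open>The first equation turns the sign into a constant nonzero factor; the exponent 1
    in the second reproduces the terms of \<open>b_sum 1\<close>.\<close>
  have abs: "arctan (s / \<beta> (Suc j)) = sgn s * \<bar>arctan (s / \<beta> (Suc j))\<bar>"
    "\<bar>s / \<beta> (Suc j)\<bar> = \<bar>s\<bar> * (1 / \<beta> (Suc j) ^ 1)" for j
    using pos_Suc[of j] s by (auto simp: sgn_if abs_if divide_less_0_iff field_simps)
  have "convergent (\<lambda>n. g_n \<beta> n s) \<longleftrightarrow> summable (\<lambda>j. arctan (s / \<beta> (Suc j)))"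
    by (simp add: summable_iff_convergent g_n_def sum.atLeast1_atMost_eq)
  also have "\<dots> \<longleftrightarrow> summable (\<lambda>j. \<bar>arctan (s / \<beta> (Suc j))\<bar>)"
    using s by (subst abs) (simp add: summable_cmult_iff sgn_eq_0_iff)
  also have "\<dots> \<longleftrightarrow> summable (\<lambda>j. \<bar>s / \<beta> (Suc j)\<bar>)"
    using pos_Suc s by (intro summable_arctan_iff lim) (simp add: less_imp_neq[symmetric])
  also have "\<dots> \<longleftrightarrow> summable (\<lambda>j. 1 / \<beta> (Suc j) ^ 1)"
    unfolding abs(2) using s by (simp only: summable_cmult_iff abs_eq_0 simp_thms)
  also have "\<dots> \<longleftrightarrow> b_sum 1 \<beta> < \<infinity>"
    by (rule b_sum_finite_iff_summable[OF pos, symmetric])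
  finally show ?thesis .
qed

section \<open>Convergence of the complex products\<close>

lemma convergent_Phi_n_iff:
  assumes \<beta>: "\<beta> \<in> B_class 2"
  shows "convergent (\<lambda>n. Phi_n n s \<beta>) \<longleftrightarrow> convergent (\<lambda>n. g_n \<beta> n s)"
proof -
  note pos = B_class_pos[OF \<beta>]
  note f = f_n_tendsto[OF \<beta>, of s]
  show ?thesis
  proof
    assume "convergent (\<lambda>n. g_n \<beta> n s)"
    then obtain r where "(\<lambda>n. g_n \<beta> n s) \<longlonglongrightarrow> r" by (auto simp: convergent_def)
    then have "(\<lambda>n. Phi_n n s \<beta>) \<longlonglongrightarrow> complex_of_real (f_lim \<beta> s) * cis (r / 2)"
      unfolding Phi_n_eq[OF pos] using f by (intro tendsto_intros) auto
    then show "convergent (\<lambda>n. Phi_n n s \<beta>)" by (auto simp: convergent_def)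
  next
    assume "convergent (\<lambda>n. Phi_n n s \<beta>)"
    then obtain L where "(\<lambda>n. Phi_n n s \<beta>) \<longlonglongrightarrow> L" by (auto simp: convergent_def)
    \<comment> \<open>The positive limit of \<open>f_n\<close> permits dividing out the modulus,
      which leaves the points on the circle.\<close>
    then have "(\<lambda>n. Phi_n n s \<beta> / complex_of_real (f_n \<beta> n s)) \<longlonglongrightarrow> L / complex_of_real (f_lim \<beta> s)"
      using f by (intro tendsto_intros) auto
    then have "(\<lambda>n. cis (g_n \<beta> n s / 2)) \<longlonglongrightarrow> L / complex_of_real (f_lim \<beta> s)"
      using f_n_pos[of \<beta> _ s] by (simp add: Phi_n_eq[OF pos] less_imp_neq[symmetric])
    then have "convergent (\<lambda>n. cis (g_n \<beta> n s / 2))" by (auto simp: convergent_def)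
    \<comment> \<open>Halving the angle bounds each step by pi/4 < 1, as
      \<open>convergent_cis_imp_convergent\<close> demands.\<close>
    moreover have "\<bar>g_n \<beta> (Suc n) s / 2 - g_n \<beta> n s / 2\<bar> \<le> 1" for n
      using arctan_lbound[of "s / \<beta> (Suc n)"] arctan_ubound[of "s / \<beta> (Suc n)"] pi_less_4
      by (simp add: g_n_Suc add_divide_distrib abs_less_iff less_imp_le abs_le_iff)
    ultimately have "convergent (\<lambda>n. g_n \<beta> n s / 2)"
      by (rule convergent_cis_imp_convergent)
    then show "convergent (\<lambda>n. g_n \<beta> n s)"
      using convergent_mult_const_iff[of 2 "\<lambda>n. g_n \<beta> n s / 2"] by simp
  qed
qed

theorem lemma3:
  fixes \<beta> :: "nat \<Rightarrow> real"
  assumes "\<beta> \<in> B_class 2"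
  shows
    "(\<forall>s::real. s \<noteq> 0 \<longrightarrow>
        convergent (\<lambda>n. f_n \<beta> n s) \<and>
        (\<forall>n\<ge>1. 0 < f_lim \<beta> s \<and> f_lim \<beta> s < f_n \<beta> (n + 1) s \<and>
                f_n \<beta> (n + 1) s < f_n \<beta> n s \<and> f_n \<beta> n s < 1) \<and>
        convergent (\<lambda>n. ereal (g_n \<beta> n s)) \<and>
        (\<bar>g_lim \<beta> s\<bar> \<noteq> \<infinity> \<longleftrightarrow> b_sum 1 \<beta> < \<infinity>) \<and>
        (convergent (\<lambda>n. Phi_n n s \<beta>) \<longleftrightarrow> b_sum 1 \<beta> < \<infinity>)) \<and>
     (\<forall>p>0. f_lim \<beta> \<in> L_p p) \<and>
     (convergent (\<lambda>n. Phi_n n 0 \<beta>) \<and> Phi_lim 0 \<beta> = 1) \<and>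
     (convergent (\<lambda>n. f_n \<beta> n 0) \<and> f_lim \<beta> 0 = 1) \<and>
     (convergent (\<lambda>n. ereal (g_n \<beta> n 0)) \<and> g_lim \<beta> 0 = 0)"
proof -
  note pos = B_class_pos[OF assms]
  have conv_f: "convergent (\<lambda>n. f_n \<beta> n s)" for s
    using f_n_tendsto(1)[OF assms] by (auto simp: convergent_def)
  have f_lim_le: "f_lim \<beta> s \<le> f_n \<beta> n s" for n s
    using decseq_ge[OF decseq_f_n[OF pos] f_n_tendsto(1)[OF assms]] .
  have f_Suc: "f_n \<beta> (n + 1) s < f_n \<beta> n s" if "s \<noteq> 0" for n s
    using f_n_Suc_less[OF _ that] pos by simp
  \<comment> \<open>Strictness comes from going one index further: the limit is at most the next
    term, which is strictly smaller.\<close>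
  have f_lim: "f_lim \<beta> s < f_n \<beta> n s" if "s \<noteq> 0" for n s
    using f_lim_le[of s "n + 1"] f_Suc[OF that] by (rule order.strict_trans1)
  have f_less_1: "f_n \<beta> n s < 1" if "s \<noteq> 0" "1 \<le> n" for n s
  proof -
    have "f_n \<beta> n s \<le> f_n \<beta> 1 s"
      using decseqD[OF decseq_f_n[OF pos] that(2)] .
    \<comment> \<open>The term at index 0 is the empty product 1.\<close>
    also have "\<dots> < f_n \<beta> 0 s" using f_Suc[OF that(1), of 0] by simp
    finally show ?thesis by (simp add: f_n_def)
  qed
  have zero: "f_n \<beta> n 0 = 1" "g_n \<beta> n 0 = 0" "Phi_n n 0 \<beta> = 1" for n
    by (simp_all add: Phi_n_eq[OF pos] f_n_def g_n_def)
  show ?thesis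
    using conv_f f_n_tendsto(2)[OF assms] f_lim f_Suc f_less_1 convergent_ereal_g_n[OF pos]
      g_lim_finite_iff_convergent[OF pos] convergent_g_n_iff[OF assms] convergent_Phi_n_iff[OF assms]
      f_lim_in_L_p[OF assms]
    by (simp add: zero Phi_lim_def f_lim_def g_lim_def convergent_const)
qed

end
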